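(* Let $w:2^{[n]}\to L$ be a nondecreasing set function, let $X_1,\ldots,X_n$ be (generally dependent) $L$-valued random variables on a common probability space, let $Y=p_w(X_1,\ldots,X_n)$, and denote the c.d.f. of $Y$ by $F_Y(y)=\Pr(Y\leqslant y)$. Then, for any $y\in L$, $$1-F_Y(y)=\sum_{\vec\kappa\in\{0,1\}^n}\mathrm{Ind}(w(S_{\vec\kappa})>y)\,\Pr(\vec\chi(y)=\vec\kappa),$$ or equivalently, $$1-F_Y(y)=\sum_{S\subseteq[n]}\mathrm{Ind}(w(S)>y)\,\Pr(\vec\chi(y)=\vec\varepsilon_S).$$
   Context: $[n]=\{1,\ldots,n\}$. $L\subseteq[-\infty,\infty]$ is a (totally ordered) bounded lattice with bottom element $a$ and top element $b$; $\wedge$ and $\vee$ denote min and max, empty meets equal $b$. For a nondecreasing set function $w:2^{[n]}\to L$ (i.e. $S\subseteq T$ implies $w(S)\leqslant w(T)$), $p_w:L^n\to L$ is the weighted lattice polynomial $p_w(\vec x)=\bigvee_{S\subseteq[n]}\big[w(S)\wedge\bigwedge_{i\in S}x_i\big]$. (Weighted lattice polynomials $L^n\to L$ are the functions built from projections and constants by finitely many applications of $\wedge$ and $\vee$; each is $p_w$ for a unique nondecreasing $w$.) $\mathrm{Ind}(A)\in\{0,1\}$ is the indicator of the event or condition $A$. $\vec\chi(x)=(\chi_1(x),\ldots,\chi_n(x))$ with $\chi_i(x)=\mathrm{Ind}(X_i>x)$. For $\vec\kappa\in\{0,1\}^n$, $S_{\vec\kappa}=\{i\in[n]:\kappa_i=1\}$;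 for $S\subseteq[n]$, $\vec\varepsilon_S\in\{0,1\}^n$ is the characteristic vector of $S$. *)

theory Defs
  imports "HOL-Probability.Probability"
begin

text \<open>
  A vector indexed by \<open>{1..n}\<close> is a function on \<open>nat\<close> of which only the values at
  \<open>1, \<dots>, n\<close> matter; vectors with entries 0 and 1 that are compared for equality are
  taken to be \<^const>\<open>extensional\<close>, so that they are determined by these values.
\<close>

text \<open>
  The top element \<open>b\<close> is an explicit argument because the empty meet is taken in the
  lattice \<open>L\<close>, whose top need not be the top of \<^typ>\<open>ereal\<close>.
\<close>

definition meet :: "ereal \<Rightarrow> (nat \<Rightarrow> ereal) \<Rightarrow> nat set \<Rightarrow> ereal" where
  "meet b x S = (if S = {} then b else Min (x ` S))"

definition wlp :: "nat \<Rightarrow> ereal \<Rightarrow> (nat set \<Rightarrow> ereal) \<Rightarrow> (nat \<Rightarrow> ereal) \<Rightarrow> ereal" where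
  "wlp n b w x = Max ((\<lambda>S. min (w S) (meet b x S)) ` Pow {1..n})"

definition zero_one_vecs :: "nat \<Rightarrow> (nat \<Rightarrow> nat) set" where
  "zero_one_vecs n = {1..n} \<rightarrow>\<^sub>E {0, 1}"

definition one_set :: "nat \<Rightarrow> (nat \<Rightarrow> nat) \<Rightarrow> nat set" where
  "one_set n \<kappa> = {i \<in> {1..n}. \<kappa> i = 1}"

definition char_vec :: "nat \<Rightarrow> nat set \<Rightarrow> nat \<Rightarrow> nat" where
  "char_vec n S = (\<lambda>i\<in>{1..n}. of_bool (i \<in> S))"

definition chi :: "nat \<Rightarrow> (nat \<Rightarrow> 'a \<Rightarrow> ereal) \<Rightarrow> ereal \<Rightarrow> 'a \<Rightarrow> nat \<Rightarrow> nat" where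
  "chi n X y \<omega> = (\<lambda>i\<in>{1..n}. of_bool (X i \<omega> > y))"

text \<open>The library's \<^const>\<open>cdf\<close> is restricted to measures on \<^typ>\<open>real\<close>.\<close>

definition ereal_cdf :: "'a measure \<Rightarrow> ('a \<Rightarrow> ereal) \<Rightarrow> ereal \<Rightarrow> real" where
  "ereal_cdf M Y y = \<P>(\<omega> in M. Y \<omega> \<le> y)"

end

theory Submission
  imports Defs
begin

text \<open>
  The tail event \<open>Y > y\<close> is determined by the random set \<open>T\<close> of the indices \<open>i\<close> with
  \<open>X\<^sub>i > y\<close>: a join exceeds \<open>y\<close> iff one of its terms does, and the term of \<open>S\<close> exceeds \<open>y\<close>
  iff \<open>w S > y\<close> and \<open>S \<subseteq> T\<close>. As \<open>w\<close> is nondecreasing, such an \<open>S\<close> exists iff \<open>T\<close>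
  itself is one, that is, iff \<open>w T > y\<close> (lemma \<open>less_wlp_iff\<close>).
  The event \<open>Y > y\<close> is thus the disjoint union of the events \<open>T = S\<close> over those of the
  finitely many \<open>S\<close> with \<open>w S > y\<close> (lemma \<open>prob_random_set\<close>), which is the sum over
  sets. Since \<open>chi\<close> is the characteristic vector of \<open>T\<close>, the sum over 0-1 vectors is the
  same sum, reindexed along the bijection between sets and characteristic vectors.
\<close>

lemma one_set_char_vec:
  assumes "S \<subseteq> {1..n}"
  shows "one_set n (char_vec n S) = S"
  using assms by (auto simp: one_set_def char_vec_def)

lemma char_vec_one_set:
  assumes "\<kappa> \<in> zero_one_vecs n"
  shows "char_vec n (one_set n \<kappa>) = \<kappa>"
proof
  fix i
  show "char_vec n (one_set n \<kappa>) i = \<kappa> i"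
    using assms by (cases "i \<in> {1..n}")
      (auto simp: one_set_def char_vec_def zero_one_vecs_def PiE_iff extensional_def)
qed

lemma char_vec_bij_betw: "bij_betw (char_vec n) (Pow {1..n}) (zero_one_vecs n)"
proof (rule bij_betw_byWitness[where f' = "one_set n"])
  show "\<forall>S\<in>Pow {1..n}. one_set n (char_vec n S) = S"
    by (simp add: one_set_char_vec)
  show "\<forall>\<kappa>\<in>zero_one_vecs n. char_vec n (one_set n \<kappa>) = \<kappa>"
    by (simp add: char_vec_one_set)
  show "char_vec n ` Pow {1..n} \<subseteq> zero_one_vecs n"
    by (auto simp: char_vec_def zero_one_vecs_def)
  show "one_set n ` zero_one_vecs n \<subseteq> Pow {1..n}"
    by (auto simp: one_set_def)
qed

lemma chi_eq_char_vec_iff: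
  assumes "S \<subseteq> {1..n}"
  shows "chi n X y \<omega> = char_vec n S \<longleftrightarrow> {i \<in> {1..n}. y < X i \<omega>} = S"
proof -
  have chi: "chi n X y \<omega> = char_vec n {i \<in> {1..n}. y < X i \<omega>}"
    by (auto simp: chi_def char_vec_def)
  show ?thesis
    using assms unfolding chi
    by (metis (no_types, lifting) one_set_char_vec mem_Collect_eq subsetI)
qed

lemma less_meet_iff:
  assumes "finite S"
  shows "y < meet b x S \<longleftrightarrow> (if S = {} then y < b else \<forall>i\<in>S. y < x i)"
  using assms by (simp add: meet_def)

text \<open>
  The bound \<open>w S \<le> b\<close> serves the empty meet: if \<open>T\<close> is empty and \<open>w T > y\<close>, the term
  of \<open>T\<close> exceeds \<open>y\<close> only because \<open>b \<ge> w T > y\<close>.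
\<close>

lemma less_wlp_iff:
  assumes mono: "mono_on (Pow {1..n}) w"
    and le_b: "\<And>S. S \<subseteq> {1..n} \<Longrightarrow> w S \<le> b"
  shows "y < wlp n b w x \<longleftrightarrow> y < w {i \<in> {1..n}. y < x i}"
proof -
  let ?T = "{i \<in> {1..n}. y < x i}"
  have fin: "finite S" if "S \<subseteq> {1..n}" for S
    using that by (rule finite_subset) simp
  have "y < wlp n b w x \<longleftrightarrow> (\<exists>S\<in>Pow {1..n}. y < w S \<and> y < meet b x S)"
    unfolding wlp_def by (subst Max_gr_iff) auto
  also have "\<dots> \<longleftrightarrow> y < w ?T"
  proof
    assume "\<exists>S\<in>Pow {1..n}. y < w S \<and> y < meet b x S"
    then obtain S where S: "S \<subseteq> {1..n}" "y < w S" "y < meet b x S"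
      by auto
    have "S \<subseteq> ?T"
      using S(1,3) fin[OF S(1)] by (auto simp: less_meet_iff split: if_splits)
    then have "w S \<le> w ?T"
      using S(1) by (intro mono_onD[OF mono]) auto
    with S(2) show "y < w ?T"
      by simp
  next
    assume less: "y < w ?T"
    then have "y < b"
      by (rule less_le_trans) (auto intro: le_b)
    then have "y < meet b x ?T"
      by (simp add: less_meet_iff)
    with less show "\<exists>S\<in>Pow {1..n}. y < w S \<and> y < meet b x S"
      by (intro bexI[of _ ?T]) auto
  qed
  finally show ?thesis .
qed

text \<open>
  A set-valued random variable with values in the subsets of a finite set \<open>I\<close> is discrete,
  so any event about it splits into the events that fix its value. Measurability of its values
  follows from that of the membership events, of which there are finitely many.
\<close>

lemma (in prob_space) prob_random_set:
  assumes fin: "finite I"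
    and meas: "\<And>i. i \<in> I \<Longrightarrow> {\<omega> \<in> space M. Q i \<omega>} \<in> events"
  shows "{\<omega> \<in> space M. P {i \<in> I. Q i \<omega>}} \<in> events"
    and "\<P>(\<omega> in M. P {i \<in> I. Q i \<omega>}) =
      (\<Sum>S\<in>Pow I. of_bool (P S) * \<P>(\<omega> in M. {i \<in> I. Q i \<omega>} = S))"
proof -
  let ?A = "\<lambda>S. {\<omega> \<in> space M. {i \<in> I. Q i \<omega>} = S}"
  let ?\<S> = "{S \<in> Pow I. P S}"
  have A: "?A S \<in> events" if "S \<in> Pow I" for S
  proof -
    have "?A S = {\<omega> \<in> space M. \<forall>i\<in>I. Q i \<omega> \<longleftrightarrow> i \<in> S}"
      using that by auto
    also have "\<dots> \<in> events"
    proof (rule sets.sets_Collect_finite_All[OF _ fin])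
      fix i assume "i \<in> I"
      then show "{\<omega> \<in> space M. Q i \<omega> \<longleftrightarrow> i \<in> S} \<in> events"
        by (cases "i \<in> S") (auto intro: meas sets.sets_Collect_neg)
    qed
    finally show ?thesis .
  qed
  have union: "{\<omega> \<in> space M. P {i \<in> I. Q i \<omega>}} = (\<Union>S\<in>?\<S>. ?A S)"
    by auto
  show "{\<omega> \<in> space M. P {i \<in> I. Q i \<omega>}} \<in> events"
    unfolding union using fin A by (intro sets.finite_UN) auto
  have "\<P>(\<omega> in M. P {i \<in> I. Q i \<omega>}) = (\<Sum>S\<in>?\<S>. prob (?A S))"
    unfolding union using fin A
    by (intro finite_measure_finite_Union) (auto simp: disjoint_family_on_def)
  also have "\<dots> = (\<Sum>S\<in>Pow I. of_bool (P S) * prob (?A S))"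
    using fin by (intro sum.mono_neutral_cong_left) auto
  finally show "\<P>(\<omega> in M. P {i \<in> I. Q i \<omega>}) =
      (\<Sum>S\<in>Pow I. of_bool (P S) * \<P>(\<omega> in M. {i \<in> I. Q i \<omega>} = S))" .
qed

theorem theorem3:
  fixes n :: nat and L :: "ereal set" and a b y :: ereal
    and w :: "nat set \<Rightarrow> ereal"
    and M :: "'a measure" and X :: "nat \<Rightarrow> 'a \<Rightarrow> ereal" and Y :: "'a \<Rightarrow> ereal"
  assumes bottom: "a \<in> L" "\<And>x. x \<in> L \<Longrightarrow> a \<le> x"
    and top: "b \<in> L" "\<And>x. x \<in> L \<Longrightarrow> x \<le> b"
    and w_L: "w \<in> Pow {1..n} \<rightarrow> L"
    and w_mono: "mono_on (Pow {1..n}) w"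
    and M: "prob_space M"
    and X: "\<And>i. i \<in> {1..n} \<Longrightarrow> X i \<in> measurable M (restrict_space borel L)"
    and Y: "\<And>\<omega>. \<omega> \<in> space M \<Longrightarrow> Y \<omega> = wlp n b w (\<lambda>i. X i \<omega>)"
    and y: "y \<in> L"
  shows "1 - ereal_cdf M Y y =
           (\<Sum>\<kappa>\<in>zero_one_vecs n. of_bool (w (one_set n \<kappa>) > y) * \<P>(\<omega> in M. chi n X y \<omega> = \<kappa>))
       \<and> 1 - ereal_cdf M Y y =
           (\<Sum>S\<in>Pow {1..n}. of_bool (w S > y) * \<P>(\<omega> in M. chi n X y \<omega> = char_vec n S))"
proof -
  interpret prob_space M by (rule M)
  let ?T = "\<lambda>\<omega>. {i \<in> {1..n}. y < X i \<omega>}"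
  have w_le: "w S \<le> b" if "S \<subseteq> {1..n}" for S
    using w_L that by (intro top(2)) auto
  have less_Y: "y < Y \<omega> \<longleftrightarrow> y < w (?T \<omega>)" if "\<omega> \<in> space M" for \<omega>
    unfolding Y[OF that] by (rule less_wlp_iff[OF w_mono w_le])
  have meas: "{\<omega> \<in> space M. y < X i \<omega>} \<in> events" if "i \<in> {1..n}" for i
  proof -
    have "X i \<in> borel_measurable M"
      using X[OF that] by (simp add: measurable_restrict_space2_iff)
    then show ?thesis
      by measurable
  qed
  note T = prob_random_set[where P = "\<lambda>S. y < w S", OF finite_atLeastAtMost meas]

  have gt: "{\<omega> \<in> space M. y < w (?T \<omega>)} \<in> events"
    by (rule T(1))
  have "{\<omega> \<in> space M. Y \<omega> \<le> y} = space M - {\<omega> \<in> space M. y < w (?T \<omega>)}"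
    using less_Y by (auto simp: not_less[symmetric])
  then have "1 - ereal_cdf M Y y = \<P>(\<omega> in M. y < w (?T \<omega>))"
    using prob_compl[OF gt] by (simp add: ereal_cdf_def)
  also have "\<dots> = (\<Sum>S\<in>Pow {1..n}. of_bool (w S > y) * \<P>(\<omega> in M. ?T \<omega> = S))"
    by (rule T(2))
  also have "\<dots> =
      (\<Sum>S\<in>Pow {1..n}. of_bool (w S > y) * \<P>(\<omega> in M. chi n X y \<omega> = char_vec n S))"
    by (intro sum.cong refl) (simp add: chi_eq_char_vec_iff)
  finally have sets: "1 - ereal_cdf M Y y =
      (\<Sum>S\<in>Pow {1..n}. of_bool (w S > y) * \<P>(\<omega> in M. chi n X y \<omega> = char_vec n S))" .
  also have "\<dots> =
      (\<Sum>S\<in>Pow {1..n}. of_bool (w (one_set n (char_vec n S)) > y) *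
        \<P>(\<omega> in M. chi n X y \<omega> = char_vec n S))"
    by (intro sum.cong refl) (simp add: one_set_char_vec)
  also have "\<dots> =
      (\<Sum>\<kappa>\<in>zero_one_vecs n. of_bool (w (one_set n \<kappa>) > y) * \<P>(\<omega> in M. chi n X y \<omega> = \<kappa>))"
    by (rule sum.reindex_bij_betw[OF char_vec_bij_betw])
  finally show ?thesis
    using sets by (rule conjI)
qed

end
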